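(* Let $P,Q$ be orthogonal projections in a Hilbert space $\mathcal{H}$ and suppose that $T=PQ$ is S-decomposable with singular values $s_n$. Then $A=P-Q$ is diagonalizable, with eigenvalues $\pm(1-s_n^2)^{1/2}$, $n\ge 1$, plus, possibly, $0$, $-1$ and $1$.
   Context: A bounded operator $T$ on $\mathcal{H}$ is called S-decomposable if it has a singular value (Schmidt) decomposition $T=\sum_{n\ge 1} s_n\langle\,\cdot\,,\xi_n\rangle\psi_n$, where $\{\xi_n: n\ge 1\}$ and $\{\psi_n: n\ge 1\}$ are orthonormal systems and $s_n>0$; the numbers $s_n$ are the singular values of $T$. A self-adjoint operator is diagonalizable if there is an orthonormal basis of the space consisting of its eigenvectors. *)

theory Defs
  imports "HOL-Analysis.Analysis" "HOL-Library.Extended_Nat"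
begin

class complex_vector = real_vector +
  fixes scaleC :: "complex \<Rightarrow> 'a \<Rightarrow> 'a" (infixr "*\<^sub>C" 75)
  assumes scaleC_add_right: "a *\<^sub>C (x + y) = a *\<^sub>C x + a *\<^sub>C y"
    and scaleC_add_left: "(a + b) *\<^sub>C x = a *\<^sub>C x + b *\<^sub>C x"
    and scaleC_scaleC: "a *\<^sub>C (b *\<^sub>C x) = (a * b) *\<^sub>C x"
    and scaleC_one: "1 *\<^sub>C x = x"
    and scaleR_scaleC: "r *\<^sub>R x = of_real r *\<^sub>C x"

text \<open>The inner product is linear in its first argument. Positive definiteness follows from
  \<open>cinner_self\<close> and the norm axioms.\<close>

class complex_inner = complex_vector + real_normed_vector +
  fixes cinner :: "'a \<Rightarrow> 'a \<Rightarrow> complex"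
  assumes cinner_add_left: "cinner (x + y) z = cinner x z + cinner y z"
    and cinner_scaleC_left: "cinner (a *\<^sub>C x) y = a * cinner x y"
    and cinner_commute: "cinner x y = cnj (cinner y x)"
    and cinner_self: "cinner x x = of_real ((norm x)\<^sup>2)"

class chilbert_space = complex_inner + complete_space

instantiation complex :: chilbert_space
begin
definition scaleC_complex :: "complex \<Rightarrow> complex \<Rightarrow> complex"
  where "scaleC_complex a x = a * x"
definition cinner_complex :: "complex \<Rightarrow> complex \<Rightarrow> complex"
  where "cinner_complex x y = x * cnj y"
instance
proof
  fix x y z a b :: complex and r :: real
  show "a *\<^sub>C (x + y) = a *\<^sub>C x + a *\<^sub>C y" "(a + b) *\<^sub>C x = a *\<^sub>C x + b *\<^sub>C x"
    "a *\<^sub>C (b *\<^sub>C x) = (a * b) *\<^sub>C x" "1 *\<^sub>C x = x" "r *\<^sub>R x = of_real r *\<^sub>C x"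
    by (simp_all add: scaleC_complex_def distrib_left distrib_right mult.assoc scaleR_conv_of_real)
  show "cinner (x + y) z = cinner x z + cinner y z" "cinner (a *\<^sub>C x) y = a * cinner x y"
    "cinner x y = cnj (cinner y x)"
    by (simp_all add: scaleC_complex_def cinner_complex_def ring_distribs ac_simps)
  show "cinner x x = of_real ((norm x)\<^sup>2)"
    by (simp only: cinner_complex_def complex_norm_square)
qed
end

global_interpretation complex_vector: vector_space "scaleC :: complex \<Rightarrow> 'a \<Rightarrow> 'a::complex_vector"
  by standard (simp_all add: scaleC_add_right scaleC_add_left scaleC_scaleC scaleC_one)

definition bounded_clinear :: "('a::complex_inner \<Rightarrow> 'a) \<Rightarrow> bool"
  where "bounded_clinear T \<longleftrightarrow> bounded_linear T \<and> (\<forall>c x. T (c *\<^sub>C x) = c *\<^sub>C T x)"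

definition self_adjoint :: "('a::complex_inner \<Rightarrow> 'a) \<Rightarrow> bool"
  where "self_adjoint T \<longleftrightarrow>
    bounded_clinear T \<and> (\<forall>x y. cinner (T x) y = cinner x (T y))"

definition orthogonal_projection :: "('a::complex_inner \<Rightarrow> 'a) \<Rightarrow> bool"
  where "orthogonal_projection P \<longleftrightarrow> self_adjoint P \<and> P \<circ> P = P"

definition orthonormal_system :: "'i set \<Rightarrow> ('i \<Rightarrow> 'a::complex_inner) \<Rightarrow> bool"
  where "orthonormal_system I e \<longleftrightarrow>
    (\<forall>i\<in>I. \<forall>j\<in>I. cinner (e i) (e j) = (if i = j then 1 else 0))"

definition orthonormal_basis :: "'a::complex_inner set \<Rightarrow> bool"
  where "orthonormal_basis B \<longleftrightarrow>
    orthonormal_system B (\<lambda>b. b) \<and> closure (complex_vector.span B) = UNIV"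

definition eigenvector :: "('a::complex_vector \<Rightarrow> 'a) \<Rightarrow> complex \<Rightarrow> 'a \<Rightarrow> bool"
  where "eigenvector T c x \<longleftrightarrow> x \<noteq> 0 \<and> T x = c *\<^sub>C x"

definition eigenvalues :: "('a::complex_vector \<Rightarrow> 'a) \<Rightarrow> complex set"
  where "eigenvalues T = {c. \<exists>x. eigenvector T c x}"

definition diagonalizable :: "('a::complex_inner \<Rightarrow> 'a) \<Rightarrow> bool"
  where "diagonalizable T \<longleftrightarrow>
    self_adjoint T \<and> (\<exists>B. orthonormal_basis B \<and> (\<forall>b\<in>B. \<exists>c. eigenvector T c b))"

text \<open>The index set \<open>{1, \<dots>, N}\<close>, or all positive integers if \<open>N = \<infinity>\<close>; a Schmidt
  decomposition may have finitely many (even no) or countably many terms.\<close>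

definition indices :: "enat \<Rightarrow> nat set"
  where "indices N = {n. 1 \<le> n \<and> enat n \<le> N}"

text \<open>\<open>S_decomposable T N s\<close>: the operator \<open>T\<close> is S-decomposable with singular values
  \<open>s n\<close>, \<open>n \<in> indices N\<close>, repetitions allowed. The series converges pointwise in norm (in
  operator norm it would converge only for finite sums or \<open>s n\<close> tending to 0); since its terms are
  orthogonal, unconditional convergence is the same as convergence of the partial sums.\<close>

definition S_decomposable :: "('a::complex_inner \<Rightarrow> 'a) \<Rightarrow> enat \<Rightarrow> (nat \<Rightarrow> real) \<Rightarrow> bool"
  where "S_decomposable T N s \<longleftrightarrow>
    bounded_clinear T \<and> (\<forall>n\<in>indices N. s n > 0) \<and>
    (\<exists>\<xi> \<psi>. orthonormal_system (indices N) \<xi> \<and> orthonormal_system (indices N) \<psi> \<and>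
      (\<forall>x. ((\<lambda>n. (of_real (s n) * cinner x (\<xi> n)) *\<^sub>C \<psi> n) has_sum T x) (indices N)))"

end

theory Submission
  imports Defs
begin

text \<open>The Schmidt vectors satisfy \<open>P \<psi>\<^sub>n = \<psi>\<^sub>n\<close>, \<open>Q \<xi>\<^sub>n = \<xi>\<^sub>n\<close>, \<open>P \<xi>\<^sub>n = s\<^sub>n \<psi>\<^sub>n\<close> and
  \<open>Q \<psi>\<^sub>n = s\<^sub>n \<xi>\<^sub>n\<close>, so \<open>A\<^sup>2 \<psi>\<^sub>n = (1 - s\<^sub>n\<^sup>2) \<psi>\<^sub>n\<close> and \<open>span {\<xi>\<^sub>n, \<psi>\<^sub>n}\<close> is spanned by eigenvectors of
  \<open>A\<close> for \<open>\<plusminus>(1 - s\<^sub>n\<^sup>2)\<^sup>1\<^sup>/\<^sup>2\<close>. A vector \<open>x\<close> orthogonal to all of these is killed by \<open>P Q\<close> and \<open>Q P\<close>, so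
  \<open>P x\<close>, \<open>Q x\<close> and \<open>x - P x - Q x\<close> are eigenvectors for \<open>1\<close>, \<open>-1\<close> and \<open>0\<close>. Hence only \<open>0\<close> is
  orthogonal to the eigenvectors for the listed eigenvalues. This excludes any other eigenvalue, and a
  maximal orthonormal set of eigenvectors of a self-adjoint operator with total eigenvectors is
  an orthonormal basis.\<close>

section \<open>Complex inner products\<close>

interpretation cinner: additive "\<lambda>x. cinner x (y::'a::complex_inner)" for y
  by standard (rule cinner_add_left)

lemma cinner_add_right: "cinner x (y + z) = cinner x y + cinner x (z::'a::complex_inner)"
  by (metis cinner_add_left cinner_commute complex_cnj_add)

interpretation cinner_right: additive "\<lambda>y. cinner (x::'a::complex_inner) y" for x
  by standard (rule cinner_add_right)

lemma cinner_scaleC_right: "cinner x (a *\<^sub>C y) = cnj a * cinner x (y::'a::complex_inner)"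
  by (metis cinner_commute cinner_scaleC_left complex_cnj_mult)

lemmas cinner_simps = cinner_add_left cinner_add_right cinner.diff cinner_right.diff
  cinner_scaleC_left cinner_scaleC_right

lemma cinner_eq_zero_commute: "cinner x y = 0 \<longleftrightarrow> cinner y (x::'a::complex_inner) = 0"
  by (metis cinner_commute complex_cnj_zero)

lemma cinner_self_eq_zero [simp]: "cinner x x = 0 \<longleftrightarrow> x = (0::'a::complex_inner)"
  by (simp add: cinner_self)

lemma cinner_ext:
  assumes "\<And>z. cinner z x = cinner z (y::'a::complex_inner)"
  shows "x = y"
proof -
  have "cinner (x - y) (x - y) = 0"
    using assms by (simp add: cinner_right.diff)
  then show ?thesis by simp
qed

text \<open>The norm axioms give homogeneity for real scalars only; the complex case is read off
  from \<open>cinner_self\<close>.\<close>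

lemma norm_scaleC: "norm (a *\<^sub>C x) = norm a * norm (x::'a::complex_inner)"
proof -
  have "complex_of_real ((norm (a *\<^sub>C x))\<^sup>2) = complex_of_real ((norm a * norm x)\<^sup>2)"
    unfolding cinner_self[symmetric] power_mult_distrib of_real_mult
    by (simp add: cinner_simps cinner_complex_def)
  then have "(norm (a *\<^sub>C x))\<^sup>2 = (norm a * norm x)\<^sup>2"
    by (simp only: of_real_eq_iff)
  then show ?thesis
    by (simp add: power2_eq_iff_nonneg)
qed

lemma parallelogram_law:
  fixes x y :: "'a::complex_inner"
  shows "(norm (x + y))\<^sup>2 + (norm (x - y))\<^sup>2 = 2 * (norm x)\<^sup>2 + 2 * (norm y)\<^sup>2"
proof -
  have "complex_of_real ((norm (x + y))\<^sup>2 + (norm (x - y))\<^sup>2)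
      = complex_of_real (2 * (norm x)\<^sup>2 + 2 * (norm y)\<^sup>2)"
    unfolding of_real_add of_real_mult cinner_self[symmetric] by (simp add: cinner_simps)
  then show ?thesis
    by (simp only: of_real_eq_iff)
qed

text \<open>Pythagoras for the component of \<open>x\<close> along \<open>y\<close>. It yields both
  the Cauchy-Schwarz inequality and the orthogonality of a nearest point.\<close>

lemma norm_diff_component:
  fixes x y :: "'a::complex_inner"
  assumes "y \<noteq> 0"
  shows "(norm (x - (cinner x y / of_real ((norm y)\<^sup>2)) *\<^sub>C y))\<^sup>2
    = (norm x)\<^sup>2 - (norm (cinner x y))\<^sup>2 / (norm y)\<^sup>2"
proof -
  define t where "t = cinner x y / of_real ((norm y)\<^sup>2)"
  have t: "t * cinner y y = cinner x y"
    using assms by (simp add: t_def cinner_self)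
  have "cinner (x - t *\<^sub>C y) (x - t *\<^sub>C y)
      = cinner x x - cnj t * cinner x y - t * (cinner y x - cnj t * cinner y y)"
    by (simp add: cinner_simps algebra_simps)
  also have "\<dots> = cinner x x - t * cinner y x"
    using t by (simp add: algebra_simps)
  also have "t * cinner y x = cinner x y * cnj (cinner x y) / of_real ((norm y)\<^sup>2)"
    by (simp add: t_def cinner_commute[of y x])
  finally have "complex_of_real ((norm (x - t *\<^sub>C y))\<^sup>2)
      = complex_of_real ((norm x)\<^sup>2 - (norm (cinner x y))\<^sup>2 / (norm y)\<^sup>2)"
    by (simp only: cinner_self of_real_diff of_real_divide complex_norm_square)
  then show ?thesis
    unfolding t_def by (simp only: of_real_eq_iff)
qed

text \<open>Cauchy-Schwarz: the left side of \<open>norm_diff_component\<close> is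
  nonnegative.\<close>

lemma norm_cinner_le: "norm (cinner x y) \<le> norm x * norm (y::'a::complex_inner)"
proof (cases "y = 0")
  case True
  then show ?thesis by (simp add: cinner_right.zero)
next
  case False
  then have "(norm (cinner x y))\<^sup>2 / (norm y)\<^sup>2 \<le> (norm x)\<^sup>2"
    using norm_diff_component[of y x] by (metis diff_ge_0_iff_ge zero_le_power2)
  with False have "(norm (cinner x y))\<^sup>2 \<le> (norm x * norm y)\<^sup>2"
    by (simp add: divide_le_eq power_mult_distrib)
  then show ?thesis
    by (rule power2_le_imp_le) simp
qed

lemma bounded_linear_cinner_left: "bounded_linear (\<lambda>x. cinner x (y::'a::complex_inner))"
  by (rule bounded_linear_intro[where K = "norm y"])
     (simp_all add: cinner_add_left scaleR_scaleC scaleC_complex_def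
       cinner_scaleC_left norm_cinner_le)

lemma bounded_linear_scaleC: "bounded_linear (\<lambda>x. a *\<^sub>C (x::'a::complex_inner))"
  by (rule bounded_linear_intro[where K = "norm a"])
     (simp_all add: scaleC_add_right scaleR_scaleC scaleC_scaleC norm_scaleC mult.commute)

section \<open>Orthogonal decomposition\<close>

text \<open>If \<open>x - p\<close> had a nonzero component along \<open>v\<close>, shifting
  \<open>p\<close> by that component would stay in \<open>S\<close> and come strictly closer to
  \<open>x\<close>.\<close>

lemma minimal_distance_orthogonal:
  fixes S :: "'a::complex_inner set"
  assumes S: "complex_vector.subspace S" and v: "v \<in> S" and p: "p \<in> S"
    and min: "\<And>y. y \<in> S \<Longrightarrow> (norm (x - p))\<^sup>2 \<le> (norm (x - y))\<^sup>2"
  shows "cinner (x - p) v = 0"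
proof (cases "v = 0")
  case False
  let ?t = "cinner (x - p) v / of_real ((norm v)\<^sup>2)"
  have "p + ?t *\<^sub>C v \<in> S"
    using S v p by (intro complex_vector.subspace_add complex_vector.subspace_scale)
  from min[OF this] have "(norm (x - p))\<^sup>2 \<le> (norm (x - p - ?t *\<^sub>C v))\<^sup>2"
    by (simp add: algebra_simps)
  with norm_diff_component[OF False, of "x - p"]
  have "(norm (cinner (x - p) v))\<^sup>2 / (norm v)\<^sup>2 \<le> 0"
    by simp
  with False show ?thesis
    by (simp add: divide_le_0_iff)
qed (simp add: cinner_right.zero)

text \<open>The midpoint of \<open>y m\<close> and \<open>y n\<close> lies in \<open>S\<close>, so
  the sum of \<open>x - y m\<close> and \<open>x - y n\<close> has squared norm at least
  \<open>4 * d\<close>. The parallelogram law then forces their difference to be small.\<close>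

lemma Cauchy_minimizing_sequence:
  fixes S :: "'a::complex_inner set" and d :: real
  assumes S: "complex_vector.subspace S" and y: "\<And>n. y n \<in> S"
    and d: "\<And>v. v \<in> S \<Longrightarrow> d \<le> (norm (x - v))\<^sup>2"
    and near: "\<And>n. (norm (x - y n))\<^sup>2 < d + 1 / real (Suc n)"
  shows "Cauchy y"
proof (rule metric_CauchyI)
  fix e :: real assume e: "e > 0"
  \<comment> \<open>With both squared distances below \<open>d + e\<^sup>2 / 4\<close>, the
    parallelogram law bounds the squared difference by
    \<open>4 * d + e\<^sup>2 - 4 * d\<close>.\<close>
  then obtain M where M: "1 / real (Suc M) < e\<^sup>2 / 4"
    using nat_approx_posE[of "e\<^sup>2 / 4"] by (auto simp: zero_less_power)
  have "dist (y m) (y n) < e" if mn: "m \<ge> M" "n \<ge> M" for m n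
  proof -
    let ?z = "(1/2) *\<^sub>C (y m + y n)"
    have "?z \<in> S"
      using S y by (intro complex_vector.subspace_add complex_vector.subspace_scale)
    then have "4 * d \<le> 4 * (norm (x - ?z))\<^sup>2"
      using d by simp
    also have "\<dots> = (norm (2 *\<^sub>C (x - ?z)))\<^sup>2"
      by (simp add: norm_scaleC power_mult_distrib)
    also have "2 *\<^sub>C (x - ?z) = (x - y m) + (x - y n)"
      using scaleC_add_left[of 1 1 x]
      by (simp add: complex_vector.scale_right_diff_distrib scaleC_scaleC scaleC_one)
    finally have 1: "4 * d \<le> (norm ((x - y m) + (x - y n)))\<^sup>2" .
    have "1 / real (Suc m) \<le> 1 / real (Suc M)" "1 / real (Suc n) \<le> 1 / real (Suc M)"
      using mn by (simp_all add: frac_le)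
    with near[of m] near[of n] M
    have "(norm (x - y m))\<^sup>2 < d + e\<^sup>2 / 4" "(norm (x - y n))\<^sup>2 < d + e\<^sup>2 / 4"
      by linarith+
    with 1 parallelogram_law[of "x - y m" "x - y n"]
    have "(norm ((x - y m) - (x - y n)))\<^sup>2 < e\<^sup>2"
      by linarith
    then have "norm ((x - y m) - (x - y n)) < e"
      using e by (simp add: power_less_imp_less_base)
    then show ?thesis
      by (simp add: dist_norm norm_minus_commute)
  qed
  then show "\<exists>M. \<forall>m\<ge>M. \<forall>n\<ge>M. dist (y m) (y n) < e"
    by blast
qed

lemma orthogonal_decomposition:
  fixes S :: "'a::chilbert_space set"
  assumes S: "complex_vector.subspace S" and "closed S"
  obtains p where "p \<in> S" and "\<And>v. v \<in> S \<Longrightarrow> cinner (x - p) v = 0"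
proof -
  let ?D = "(\<lambda>v. (norm (x - v))\<^sup>2) ` S"
  define d where "d = Inf ?D"
  have ne: "?D \<noteq> {}"
    using complex_vector.subspace_0[OF S] by blast
  have d: "d \<le> (norm (x - v))\<^sup>2" if "v \<in> S" for v
    unfolding d_def using that by (intro cInf_lower bdd_belowI[of _ 0]) auto
  have "\<exists>v\<in>S. (norm (x - v))\<^sup>2 < d + 1 / real (Suc n)" for n
    using cInf_lessD[OF ne, of "d + 1 / real (Suc n)"] by (auto simp: d_def)
  then obtain y where y: "\<And>n. y n \<in> S"
    and near: "\<And>n. (norm (x - y n))\<^sup>2 < d + 1 / real (Suc n)"
    by metis
  have "Cauchy y"
    using S y d near by (rule Cauchy_minimizing_sequence)
  then obtain p where p: "y \<longlonglongrightarrow> p"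
    using Cauchy_convergent convergent_def by blast
  have "p \<in> S"
    using \<open>closed S\<close> y p by (rule closed_sequentially)
  have lim: "(\<lambda>n. (norm (x - y n))\<^sup>2) \<longlonglongrightarrow> (norm (x - p))\<^sup>2"
    by (intro tendsto_intros p)
  have "(\<lambda>n. d + 1 / real (Suc n)) \<longlonglongrightarrow> d + 0"
    by (intro tendsto_intros LIMSEQ_Suc lim_1_over_n)
  then have "(norm (x - p))\<^sup>2 \<le> d + 0"
    using lim near by (meson LIMSEQ_le less_imp_le)
  with d have "(norm (x - p))\<^sup>2 \<le> (norm (x - v))\<^sup>2" if "v \<in> S" for v
    using that by (metis add.right_neutral order_trans)
  with S \<open>p \<in> S\<close> that show thesis
    by (metis minimal_distance_orthogonal)
qed

lemma closure_csubspace: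
  fixes S :: "'a::complex_inner set"
  assumes S: "complex_vector.subspace S"
  shows "complex_vector.subspace (closure S)"
proof (rule complex_vector.subspaceI)
  show "0 \<in> closure S"
    using closure_subset complex_vector.subspace_0[OF S] by blast
next
  fix x y assume "x \<in> closure S" "y \<in> closure S"
  then obtain u v where "\<forall>n. u n \<in> S" "u \<longlonglongrightarrow> x" "\<forall>n. v n \<in> S" "v \<longlonglongrightarrow> y"
    by (auto simp: closure_sequential)
  then have "\<forall>n. u n + v n \<in> S" "(\<lambda>n. u n + v n) \<longlonglongrightarrow> x + y"
    using S by (auto intro: tendsto_add complex_vector.subspace_add)
  then show "x + y \<in> closure S"
    unfolding closure_sequential by (intro exI[of _ "\<lambda>n. u n + v n"] conjI)
next
  fix c x assume "x \<in> closure S"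
  moreover have "(\<lambda>x. c *\<^sub>C x) ` closure S \<subseteq> closure S"
    using complex_vector.subspace_scale[OF S] closure_subset
    by (intro image_closure_subset linear_continuous_on bounded_linear_scaleC) auto
  ultimately show "c *\<^sub>C x \<in> closure S"
    by blast
qed

section \<open>Self-adjoint operators with total eigenvectors\<close>

lemma self_adjointD:
  assumes "self_adjoint A"
  shows "bounded_linear A" and "A (c *\<^sub>C x) = c *\<^sub>C A x"
    and "cinner (A x) y = cinner x (A y)"
  using assms by (auto simp: self_adjoint_def bounded_clinear_def)

lemma self_adjoint_diff:
  assumes "self_adjoint A" and "self_adjoint B"
  shows "self_adjoint (\<lambda>x. A x - B x)"
  using assms
  by (simp add: self_adjoint_def bounded_clinear_def bounded_linear_sub cinner_simps
      complex_vector.scale_right_diff_distrib)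

text \<open>Moving \<open>A\<close> across the inner product gives c<x,y> = cnj d <x,y>, and d is
  real when y is nonzero.\<close>

lemma self_adjoint_eigenvectors_orthogonal:
  assumes A: "self_adjoint A" and x: "A x = c *\<^sub>C x" and y: "A y = d *\<^sub>C y" and "c \<noteq> d"
  shows "cinner x y = 0"
proof (cases "x = 0 \<or> y = 0")
  case True
  then show ?thesis by (auto simp: cinner.zero cinner_right.zero)
next
  case False
  have real: "cnj e = e" if "A z = e *\<^sub>C z" "z \<noteq> 0" for e z
    using self_adjointD(3)[OF A, of z z] that by (simp add: cinner_simps)
  have "c * cinner x y = cnj d * cinner x y"
    using self_adjointD(3)[OF A, of x y] x y by (simp add: cinner_simps)
  with real[OF y] False \<open>c \<noteq> d\<close> show ?thesis by simp
qed

lemma orthonormal_system_insert: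
  assumes "orthonormal_system B (\<lambda>b. b)" and "cinner w w = 1"
    and "\<And>b. b \<in> B \<Longrightarrow> cinner w b = 0"
  shows "orthonormal_system (insert w B) (\<lambda>b. b)"
  using assms unfolding orthonormal_system_def
  by (auto simp: cinner_eq_zero_commute[of _ w])

text \<open>Zorn's lemma. An eigenvector orthogonal to all of a maximal \<open>B\<close> could be
  normalized and added to \<open>B\<close>.\<close>

lemma ex_maximal_orthonormal_eigenvectors:
  fixes A :: "'a::complex_inner \<Rightarrow> 'a"
  assumes scale: "\<And>a x. A (a *\<^sub>C x) = a *\<^sub>C A x"
  obtains B where "orthonormal_system B (\<lambda>b. b)" and "\<And>b. b \<in> B \<Longrightarrow> \<exists>c. eigenvector A c b"
    and "\<And>w c. eigenvector A c w \<Longrightarrow> \<exists>b\<in>B. cinner w b \<noteq> 0"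
proof -
  let ?F = "{B. orthonormal_system B (\<lambda>b. b) \<and> (\<forall>b\<in>B. \<exists>c. eigenvector A c b)}"
  have "\<exists>B\<in>?F. \<forall>X\<in>?F. B \<subseteq> X \<longrightarrow> X = B"
  proof (rule subset_Zorn')
    fix C assume C: "subset.chain ?F C"
    have "orthonormal_system (\<Union>C) (\<lambda>b. b)"
      unfolding orthonormal_system_def
    proof (intro ballI)
      fix i j assume "i \<in> \<Union>C" "j \<in> \<Union>C"
      with C obtain X where "X \<in> C" "i \<in> X" "j \<in> X"
        unfolding subset_chain_def by blast
      moreover from this C have "orthonormal_system X (\<lambda>b. b)"
        unfolding subset_chain_def by blast
      ultimately show "cinner i j = (if i = j then 1 else 0)"
        by (simp add: orthonormal_system_def)
    qed
    with C show "\<Union>C \<in> ?F"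
      unfolding subset_chain_def by blast
  qed
  then obtain B where BF: "B \<in> ?F" and max: "\<forall>X\<in>?F. B \<subseteq> X \<longrightarrow> X = B"
    by (rule bexE)
  from BF have B: "orthonormal_system B (\<lambda>b. b)" "\<forall>b\<in>B. \<exists>c. eigenvector A c b"
    by simp_all
  show thesis
  proof (rule that)
    show "orthonormal_system B (\<lambda>b. b)" "\<And>b. b \<in> B \<Longrightarrow> \<exists>c. eigenvector A c b"
      using B by auto
    fix w c assume w: "eigenvector A c w"
    show "\<exists>b\<in>B. cinner w b \<noteq> 0"
    proof (rule ccontr)
      assume "\<not> ?thesis"
      then have orth: "cinner w b = 0" if "b \<in> B" for b
        using that by blast
      define v where "v = complex_of_real (1 / norm w) *\<^sub>C w"
      have "w \<noteq> 0" "A w = c *\<^sub>C w"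
        using w by (auto simp: eigenvector_def)
      then have v: "cinner v v = 1" "A v = c *\<^sub>C v"
        by (simp_all add: v_def scale cinner_scaleC_left cinner_scaleC_right cinner_self
            norm_scaleC norm_divide scaleC_scaleC power2_eq_square mult.commute)
      then have "v \<noteq> 0"
        by (auto simp: cinner.zero)
      have "orthonormal_system (insert v B) (\<lambda>b. b)"
        using B(1) v(1) orth
        by (intro orthonormal_system_insert) (simp_all add: v_def cinner_scaleC_left)
      moreover have "eigenvector A c v"
        using v(2) \<open>v \<noteq> 0\<close> by (simp add: eigenvector_def)
      ultimately have "insert v B = B"
        using B(2) by (intro max[rule_format]) auto
      then have "cinner w v = 0"
        using orth by blast
      then show False
        using v(1) \<open>w \<noteq> 0\<close> by (simp add: v_def cinner_scaleC_left cinner_scaleC_right)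
    qed
  qed
qed

text \<open>The closed span \<open>S\<close> of a maximal \<open>B\<close> is invariant under
  \<open>A\<close>, hence so is its orthogonal complement. The part of an eigenvector orthogonal to
  \<open>S\<close> is thus zero or an eigenvector orthogonal to \<open>B\<close>, and maximality
  excludes the latter. So \<open>S\<close> contains all eigenvectors, and totality leaves nothing
  orthogonal to \<open>S\<close>.\<close>

lemma diagonalizableI:
  fixes A :: "'a::chilbert_space \<Rightarrow> 'a"
  assumes A: "self_adjoint A"
    and total: "\<And>x. (\<And>c y. A y = c *\<^sub>C y \<Longrightarrow> cinner x y = 0) \<Longrightarrow> x = 0"
  shows "diagonalizable A"
proof -
  obtain B where B: "orthonormal_system B (\<lambda>b. b)"
    and eig: "\<And>b. b \<in> B \<Longrightarrow> \<exists>c. eigenvector A c b"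
    and max: "\<And>w c. eigenvector A c w \<Longrightarrow> \<exists>b\<in>B. cinner w b \<noteq> 0"
    by (rule ex_maximal_orthonormal_eigenvectors[OF self_adjointD(2)[OF A]]) (rule that; blast)
  define S where "S = closure (complex_vector.span B)"
  have S: "complex_vector.subspace S" "closed S"
    by (simp_all add: S_def closure_csubspace)
  have BS: "B \<subseteq> S"
    unfolding S_def using complex_vector.span_superset closure_subset by blast
  note lin = self_adjointD(1)[OF A]
  have "A x \<in> complex_vector.span B" if "x \<in> complex_vector.span B" for x
    using that
  proof (induction rule: complex_vector.span_induct_alt)
    case base
    then show ?case
      by (simp add: linear_simps(3)[OF lin] complex_vector.span_zero)
  next
    case (step a b y)
    then obtain c where "A b = c *\<^sub>C b"
      using eig by (auto simp: eigenvector_def)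
    then show ?case
      using step
      by (simp add: linear_simps(1)[OF lin] self_adjointD(2)[OF A] complex_vector.span_add
          complex_vector.span_scale complex_vector.span_base)
  qed
  then have "A ` S \<subseteq> S"
    unfolding S_def using closure_subset
    by (intro image_closure_subset linear_continuous_on[OF lin]) auto
  then have AS: "A x \<in> S" if "x \<in> S" for x
    using that by blast
  have eigS: "v \<in> S" if v: "A v = c *\<^sub>C v" for c v
  proof -
    obtain p where p: "p \<in> S" and orth: "\<And>u. u \<in> S \<Longrightarrow> cinner (v - p) u = 0"
      using orthogonal_decomposition[OF S] by blast
    let ?w = "v - p"
    \<comment> \<open>This vector lies in \<open>S\<close> by its right-hand form and is orthogonal
      to \<open>S\<close> by its left-hand form, so it vanishes.\<close>
    have diff: "A ?w - c *\<^sub>C ?w = c *\<^sub>C p - A p"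
      by (simp add: linear_simps(2)[OF lin] v complex_vector.scale_right_diff_distrib)
    then have inS: "A ?w - c *\<^sub>C ?w \<in> S"
      using S(1) p AS
      by (simp add: complex_vector.subspace_diff complex_vector.subspace_scale)
    have "cinner (A ?w - c *\<^sub>C ?w) u = 0" if "u \<in> S" for u
      using that orth[OF that] orth[OF AS[OF that]]
      by (simp add: cinner.diff[of "A ?w"] cinner_scaleC_left self_adjointD(3)[OF A])
    from this[OF inS] have "A ?w = c *\<^sub>C ?w"
      by simp
    with max[of c ?w] orth BS have "?w = 0"
      by (auto simp: eigenvector_def)
    with p show ?thesis by simp
  qed
  have "x \<in> S" for x
  proof -
    obtain p where p: "p \<in> S" and orth: "\<And>u. u \<in> S \<Longrightarrow> cinner (x - p) u = 0"
      using orthogonal_decomposition[OF S] by blast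
    then have "x - p = 0"
      using eigS by (intro total) auto
    with p show ?thesis by simp
  qed
  then have "orthonormal_basis B"
    using B by (auto simp: orthonormal_basis_def S_def)
  with A eig show ?thesis
    by (auto simp: diagonalizable_def)
qed

section \<open>Schmidt decompositions of products of projections\<close>

text \<open>The fourth and sixth facts express weakly, without naming the adjoint, that T* sends
  \<psi>_n to s_n \<xi>_n and kills every vector orthogonal to all \<psi>_n.\<close>

lemma S_decomposableE:
  fixes T :: "'a::complex_inner \<Rightarrow> 'a"
  assumes "S_decomposable T N s"
  obtains \<xi> \<psi> where
    "\<And>n. n \<in> indices N \<Longrightarrow> cinner (\<xi> n) (\<xi> n) = 1"
    "\<And>n. n \<in> indices N \<Longrightarrow> cinner (\<psi> n) (\<psi> n) = 1"
    "\<And>n. n \<in> indices N \<Longrightarrow> T (\<xi> n) = of_real (s n) *\<^sub>C \<psi> n"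
    "\<And>n x. n \<in> indices N \<Longrightarrow> cinner (T x) (\<psi> n) = of_real (s n) * cinner x (\<xi> n)"
    "\<And>x. (\<And>n. n \<in> indices N \<Longrightarrow> cinner x (\<xi> n) = 0) \<Longrightarrow> T x = 0"
    "\<And>x z. (\<And>n. n \<in> indices N \<Longrightarrow> cinner z (\<psi> n) = 0) \<Longrightarrow> cinner (T x) z = 0"
proof -
  let ?I = "indices N"
  obtain \<xi> \<psi> where \<xi>: "orthonormal_system ?I \<xi>" and \<psi>: "orthonormal_system ?I \<psi>"
    and sum: "\<And>x. ((\<lambda>n. (of_real (s n) * cinner x (\<xi> n)) *\<^sub>C \<psi> n) has_sum T x) ?I"
    using assms unfolding S_decomposable_def by blast
  note \<xi>D = \<xi>[unfolded orthonormal_system_def, rule_format]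
  note \<psi>D = \<psi>[unfolded orthonormal_system_def, rule_format]
  have sum_cinner: "((\<lambda>n. of_real (s n) * cinner x (\<xi> n) * cinner (\<psi> n) z) has_sum cinner (T x) z) ?I"
    for x z
    using has_sum_bounded_linear[OF bounded_linear_cinner_left[of z] sum[of x]]
    by (simp add: o_def cinner_scaleC_left)
  show thesis
  proof (rule that)
    show "cinner (\<xi> n) (\<xi> n) = 1" "cinner (\<psi> n) (\<psi> n) = 1" if "n \<in> ?I" for n
      using that \<xi>D \<psi>D by simp_all
    show "T (\<xi> n) = of_real (s n) *\<^sub>C \<psi> n" if n: "n \<in> ?I" for n
    proof (rule has_sum_unique[OF sum])
      show "((\<lambda>m. (of_real (s m) * cinner (\<xi> n) (\<xi> m)) *\<^sub>C \<psi> m) has_sum of_real (s n) *\<^sub>C \<psi> n) ?I"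
        using n by (intro has_sum_finite_neutralI[of "{n}"]) (auto simp: \<xi>D)
    qed
    show "cinner (T x) (\<psi> n) = of_real (s n) * cinner x (\<xi> n)" if n: "n \<in> ?I" for n x
    proof (rule has_sum_unique[OF sum_cinner])
      show "((\<lambda>m. of_real (s m) * cinner x (\<xi> m) * cinner (\<psi> m) (\<psi> n)) has_sum
          of_real (s n) * cinner x (\<xi> n)) ?I"
        using n by (intro has_sum_finite_neutralI[of "{n}"]) (auto simp: \<psi>D)
    qed
    show "T x = 0" if "\<And>n. n \<in> ?I \<Longrightarrow> cinner x (\<xi> n) = 0" for x
      using that by (intro has_sum_unique[OF sum] has_sum_0) simp
    show "cinner (T x) z = 0" if "\<And>n. n \<in> ?I \<Longrightarrow> cinner z (\<psi> n) = 0" for x z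
      using that by (intro has_sum_unique[OF sum_cinner] has_sum_0) (simp add: cinner_eq_zero_commute[of _ z])
  qed
qed

theorem theorem2p2:
  fixes P Q :: "'a::chilbert_space \<Rightarrow> 'a"
    and N :: enat and s :: "nat \<Rightarrow> real"
  assumes "orthogonal_projection P" and "orthogonal_projection Q"
    and "S_decomposable (P \<circ> Q) N s"
  shows "let A = (\<lambda>x. P x - Q x);
             E = (\<Union>n\<in>indices N.
                    {complex_of_real (sqrt (1 - (s n)\<^sup>2)), - complex_of_real (sqrt (1 - (s n)\<^sup>2))})
         in diagonalizable A \<and> E \<subseteq> eigenvalues A \<and> eigenvalues A \<subseteq> E \<union> {0, - 1, 1}"
proof -
  define A where "A = (\<lambda>x. P x - Q x)"
  define r where "r n = complex_of_real (sqrt (1 - (s n)\<^sup>2))" for n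
  define E where "E = (\<Union>n\<in>indices N. {r n, - r n})"
  have sa: "self_adjoint P" "self_adjoint Q"
    and idem: "P (P x) = P x" "Q (Q x) = Q x" for x
    using assms(1,2) by (auto simp: orthogonal_projection_def o_def dest: fun_cong)
  note linP = linear_simps(1-3)[OF self_adjointD(1)[OF sa(1)]] self_adjointD(2)[OF sa(1)]
  note linQ = linear_simps(1-3)[OF self_adjointD(1)[OF sa(2)]] self_adjointD(2)[OF sa(2)]
  note adj = self_adjointD(3)[OF sa(1)] self_adjointD(3)[OF sa(2)]
  have A: "self_adjoint A"
    unfolding A_def using sa by (rule self_adjoint_diff)
  note linA = linear_simps(1-3)[OF self_adjointD(1)[OF A]] self_adjointD(2)[OF A]
  have s_pos: "s n > 0" if "n \<in> indices N" for n
    using assms(3) that by (simp add: S_decomposable_def)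
  have "S_decomposable (\<lambda>x. P (Q x)) N s"
    using assms(3) by (simp only: o_def)
  then obtain \<xi> \<psi> where
    \<xi>1: "\<And>n. n \<in> indices N \<Longrightarrow> cinner (\<xi> n) (\<xi> n) = 1" and
    \<psi>1: "\<And>n. n \<in> indices N \<Longrightarrow> cinner (\<psi> n) (\<psi> n) = 1" and
    PQ\<xi>: "\<And>n. n \<in> indices N \<Longrightarrow> P (Q (\<xi> n)) = of_real (s n) *\<^sub>C \<psi> n" and
    PQ\<psi>: "\<And>n x. n \<in> indices N \<Longrightarrow> cinner (P (Q x)) (\<psi> n) = of_real (s n) * cinner x (\<xi> n)" and
    kernel: "\<And>x. (\<And>n. n \<in> indices N \<Longrightarrow> cinner x (\<xi> n) = 0) \<Longrightarrow> P (Q x) = 0" and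
    range: "\<And>x z. (\<And>n. n \<in> indices N \<Longrightarrow> cinner z (\<psi> n) = 0) \<Longrightarrow> cinner (P (Q x)) z = 0"
  proof (rule S_decomposableE, goal_cases)
    case (1 \<xi> \<psi>)
    show ?case
      by (rule that[of \<xi> \<psi>]) (fact 1)+
  qed
  \<comment> \<open>QP is the adjoint of PQ, so this is \<open>PQ\<psi>\<close> tested against every
    vector.\<close>
  have QP\<psi>: "Q (P (\<psi> n)) = of_real (s n) *\<^sub>C \<xi> n" if "n \<in> indices N" for n
    by (rule cinner_ext) (simp add: adj[symmetric] PQ\<psi>[OF that] cinner_scaleC_right)
  \<comment> \<open>A nonzero multiple of \<psi>_n is in the range of \<open>P\<close>; likewise
    below for \<xi>_n and \<open>Q\<close>.\<close>
  have P\<psi>: "P (\<psi> n) = \<psi> n" if "n \<in> indices N" for n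
  proof -
    have "of_real (s n) *\<^sub>C P (\<psi> n) = of_real (s n) *\<^sub>C \<psi> n"
      by (simp only: linP(4)[symmetric] PQ\<xi>[OF that, symmetric] idem)
    with s_pos[OF that] show ?thesis by simp
  qed
  have Q\<xi>: "Q (\<xi> n) = \<xi> n" if "n \<in> indices N" for n
  proof -
    have "of_real (s n) *\<^sub>C Q (\<xi> n) = of_real (s n) *\<^sub>C \<xi> n"
      by (simp only: linQ(4)[symmetric] QP\<psi>[OF that, symmetric] idem)
    with s_pos[OF that] show ?thesis by simp
  qed
  have A\<psi>: "A (\<psi> n) = \<psi> n - of_real (s n) *\<^sub>C \<xi> n" if "n \<in> indices N" for n
    using QP\<psi>[OF that] by (simp add: A_def P\<psi>[OF that])
  have A\<xi>: "A (\<xi> n) = of_real (s n) *\<^sub>C \<psi> n - \<xi> n" if "n \<in> indices N" for n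
    using PQ\<xi>[OF that] by (simp add: A_def Q\<xi>[OF that])
  have AA\<psi>: "A (A (\<psi> n)) = (1 - (of_real (s n))\<^sup>2) *\<^sub>C \<psi> n" if n: "n \<in> indices N" for n
    unfolding A\<psi>[OF n] linA A\<xi>[OF n]
    by (simp add: complex_vector.scale_right_diff_distrib complex_vector.scale_left_diff_distrib
        scaleC_scaleC scaleC_one power2_eq_square)
  \<comment> \<open>This serves twice: it makes the radicand in \<open>r n\<close> nonnegative, and
    it gives A \<psi>_n = 0 when \<open>r n = 0\<close>.\<close>
  have norm_A\<psi>: "(norm (A (\<psi> n)))\<^sup>2 = 1 - (s n)\<^sup>2" if n: "n \<in> indices N" for n
  proof -
    have "cinner (A (\<psi> n)) (A (\<psi> n)) = 1 - (of_real (s n))\<^sup>2"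
      by (simp add: self_adjointD(3)[OF A, of "\<psi> n"] AA\<psi>[OF n] cinner_scaleC_right \<psi>1[OF n])
    then show ?thesis
      unfolding cinner_self using of_real_eq_iff by fastforce
  qed
  have s_le: "(s n)\<^sup>2 \<le> 1" if n: "n \<in> indices N" for n
    using norm_A\<psi>[OF n] by (metis diff_ge_0_iff_ge zero_le_power2)
  have r2: "r n * r n = 1 - (of_real (s n))\<^sup>2" if n: "n \<in> indices N" for n
    using s_le[OF n] by (simp add: r_def of_real_mult[symmetric] del: of_real_mult)
  \<comment> \<open>For e = \<plusminus>r_n, (A - e)(A + e) \<psi>_n = (A^2 - e^2) \<psi>_n = 0, so
    (A + e) \<psi>_n is zero or an eigenvector for e.\<close>
  define u where "u e n = A (\<psi> n) + e *\<^sub>C \<psi> n" for e n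
  have Au: "A (u e n) = e *\<^sub>C u e n" if n: "n \<in> indices N" and e: "e = r n \<or> e = - r n" for e n
  proof -
    have "e * e = 1 - (of_real (s n))\<^sup>2"
      using e r2[OF n] by auto
    then show ?thesis
      unfolding u_def linA AA\<psi>[OF n] by (simp add: scaleC_add_right scaleC_scaleC add.commute)
  qed
  \<comment> \<open>Only the listed values of \<open>c\<close> are tested, so that this gives
    totality and also rules out every other eigenvalue.\<close>
  have total: "x = 0" if orth: "\<And>c y. c \<in> E \<union> {0, - 1, 1} \<Longrightarrow> A y = c *\<^sub>C y \<Longrightarrow> cinner x y = 0" for x
  proof -
    have *: "cinner x (\<psi> n) = 0 \<and> cinner x (A (\<psi> n)) = 0" if n: "n \<in> indices N" for n
    proof -
      have u0: "cinner x (A (\<psi> n)) + cnj e * cinner x (\<psi> n) = 0" if "e = r n \<or> e = - r n" for e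
      proof -
        have "e \<in> E \<union> {0, - 1, 1}"
          using n that by (auto simp: E_def)
        then have "cinner x (u e n) = 0"
          using orth Au[OF n that] by blast
        then show ?thesis
          by (simp add: u_def cinner_simps)
      qed
      \<comment> \<open>Add and subtract the two equations.\<close>
      from u0[of "r n"] u0[of "- r n"]
      have 1: "cinner x (A (\<psi> n)) = 0" and 2: "r n = 0 \<or> cinner x (\<psi> n) = 0"
        by (auto simp: add_eq_0_iff)
      \<comment> \<open>Here both vectors \<open>u\<close> vanish and carry no information, but
        \<psi>_n itself is an eigenvector for 0.\<close>
      have "cinner x (\<psi> n) = 0" if "r n = 0"
      proof -
        have "A (\<psi> n) = 0"
          using that norm_A\<psi>[OF n] by (simp add: r_def)
        then show ?thesis
          by (intro orth[of 0]) auto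
      qed
      with 1 2 show ?thesis by blast
    qed
    have \<psi>0: "cinner x (\<psi> n) = 0" if "n \<in> indices N" for n
      using *[OF that] by blast
    have \<xi>0: "cinner x (\<xi> n) = 0" if "n \<in> indices N" for n
      using *[OF that] s_pos[OF that] unfolding A\<psi>[OF that] by (auto simp: cinner_simps)
    have PQ: "P (Q x) = 0"
      by (rule kernel) (rule \<xi>0)
    have QP: "Q (P x) = 0"
      by (rule cinner_ext) (use range[OF \<psi>0] in \<open>simp add: adj[symmetric] cinner_right.zero\<close>)
    \<comment> \<open>The three vectors sum to \<open>x\<close>. Some may be zero, which is harmless
      since \<open>orth\<close> asks only for the eigenvalue equation.\<close>
    have "cinner x (P x) = 0" "cinner x (Q x) = 0" "cinner x (x - P x - Q x) = 0"
      using orth[of 1 "P x"] orth[of "- 1" "Q x"] orth[of 0 "x - P x - Q x"]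
      by (simp_all add: A_def linP linQ idem PQ QP scaleC_one)
    then show ?thesis
      by (simp add: cinner_simps)
  qed
  have "diagonalizable A"
    using A by (rule diagonalizableI) (use total in blast)
  moreover have "E \<subseteq> eigenvalues A"
  proof
    fix e assume "e \<in> E"
    then obtain n where n: "n \<in> indices N" and e: "e = r n \<or> e = - r n"
      by (auto simp: E_def)
    show "e \<in> eigenvalues A"
    proof (cases "u e n = 0")
      case False
      with Au[OF n e] show ?thesis
        by (auto simp: eigenvalues_def eigenvector_def)
    next
      \<comment> \<open>Now A \<psi>_n = -e \<psi>_n, while <A \<psi>_n, \<psi>_n> = 1 - s_n^2 = e^2
        because <\<xi>_n, \<psi>_n> = s_n. Hence e^2 = -e. As s_n > 0 excludes e = -1, e is 0 and
        \<psi>_n is the eigenvector sought.\<close>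
      case True
      have e2: "e * e = 1 - (of_real (s n))\<^sup>2"
        using e r2[OF n] by auto
      have "cinner (\<xi> n) (\<psi> n) = cinner (P (Q (\<xi> n))) (\<psi> n)"
        by (simp add: adj(1) P\<psi>[OF n] Q\<xi>[OF n])
      then have "cinner (A (\<psi> n)) (\<psi> n) = e * e"
        unfolding A\<psi>[OF n] e2
        by (simp add: PQ\<xi>[OF n] cinner_simps \<psi>1[OF n] power2_eq_square)
      moreover have "A (\<psi> n) = - e *\<^sub>C \<psi> n"
        using True by (simp add: u_def eq_neg_iff_add_eq_0)
      ultimately have "e * e = - e"
        using \<psi>1[OF n] by (metis cinner_scaleC_left mult.right_neutral)
      then have "e * (e + 1) = 0"
        by (simp add: distrib_left)
      moreover have "e \<noteq> - 1"
        using e2 s_pos[OF n] by auto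
      ultimately have "e = 0"
        by (simp add: eq_neg_iff_add_eq_0)
      with True have "A (\<psi> n) = e *\<^sub>C \<psi> n"
        by (simp add: u_def)
      moreover have "\<psi> n \<noteq> 0"
        using \<psi>1[OF n] by (auto simp: cinner.zero)
      ultimately show ?thesis
        by (auto simp: eigenvalues_def eigenvector_def)
    qed
  qed
  moreover have "eigenvalues A \<subseteq> E \<union> {0, - 1, 1}"
  proof (rule subsetI, rule ccontr)
    fix c assume "c \<in> eigenvalues A" and c: "c \<notin> E \<union> {0, - 1, 1}"
    then obtain x where x: "x \<noteq> 0" "A x = c *\<^sub>C x"
      by (auto simp: eigenvalues_def eigenvector_def)
    \<comment> \<open>Since \<open>c\<close> differs from every listed value, \<open>x\<close> is
      orthogonal to all the vectors that \<open>total\<close> tests.\<close>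
    have "x = 0"
      using self_adjoint_eigenvectors_orthogonal[OF A x(2)] c by (intro total) blast
    with x show False by simp
  qed
  ultimately show ?thesis
    by (simp add: Let_def A_def E_def r_def)
qed

end
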